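(* The function $f:[0,1]\to[\frac12,1]$ defined by $$f\left(\Delta^2_{\alpha_1\alpha_2\ldots\alpha_{2n-1}\alpha_{2n}\ldots}\right)=\Delta^{A_2}_{\left(\frac12\right)^{1-\alpha_1}\left(\frac12\right)^{\alpha_2}\ldots\left(\frac12\right)^{1-\alpha_{2n-1}}\left(\frac12\right)^{\alpha_{2n}}\ldots},\qquad \alpha_n\in\{0,1\},$$ is singular.
   Context: For a sequence $(\alpha_n)_{n\ge1}$ with $\alpha_n\in\{0,1\}$, $\Delta^2_{\alpha_1\alpha_2\ldots\alpha_n\ldots}=\sum_{n=1}^\infty \frac{\alpha_n}{2^n}\in[0,1]$ denotes the classical binary representation. Let $A_2=\{\frac12,1\}$. For a sequence $(a_n)_{n\ge1}$ with $a_n\in A_2$, $\Delta^{A_2}_{a_1a_2\ldots a_n\ldots}$ denotes the value of the infinite continued fraction $$[0;a_1,a_2,a_3,\ldots]=\cfrac{1}{a_1+\cfrac{1}{a_2+\cfrac{1}{a_3+\cdots}}},$$ i.e. the limit of its convergents $p_n/q_n$, where $p_n=a_np_{n-1}+p_{n-2}$, $q_n=a_nq_{n-1}+q_{n-2}$ for $n\ge1$, with $p_0=0$, $q_0=1$, $p_{-1}=1$, $q_{-1}=0$. These limits exist and lie in $[\frac12,1]$. In the definition of $f$, the $n$-th digit of the continued fraction is $(\frac12)^{1-\alpha_n}$ for odd $n$ and $(\frac12)^{\alpha_n}$ for even $n$. The function $f$ is well-defined: the two binary representations of a binary-rational number yield the same value. A function on an interval is called singular if it is continuous, non-constant, and its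 derivative exists and equals $0$ almost everywhere with respect to Lebesgue measure. *)

theory Defs
  imports "HOL-Analysis.Analysis"
begin

text \<open>
  All digit sequences are indexed from 1; the entry at index 0 is never used.
\<close>

definition binary_digits :: "(nat \<Rightarrow> nat) \<Rightarrow> bool" where
  "binary_digits \<alpha> \<longleftrightarrow> (\<forall>n\<ge>1. \<alpha> n \<in> {0, 1})"

definition binary_value :: "(nat \<Rightarrow> nat) \<Rightarrow> real" where
  "binary_value \<alpha> = (\<Sum>n. real (\<alpha> (Suc n)) / 2 ^ Suc n)"

text \<open>
  The convergents of \<open>[0; a 1, a 2, \<dots>]\<close>. The equations at \<open>Suc 0\<close> are the general recurrence
  evaluated with the conventional values \<open>1\<close> (numerator) and \<open>0\<close> (denominator) at index \<open>-1\<close>.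
\<close>

fun cf_num :: "(nat \<Rightarrow> real) \<Rightarrow> nat \<Rightarrow> real" where
  "cf_num a 0 = 0"
| "cf_num a (Suc 0) = a 1 * cf_num a 0 + 1"
| "cf_num a (Suc (Suc n)) = a (Suc (Suc n)) * cf_num a (Suc n) + cf_num a n"

fun cf_den :: "(nat \<Rightarrow> real) \<Rightarrow> nat \<Rightarrow> real" where
  "cf_den a 0 = 1"
| "cf_den a (Suc 0) = a 1 * cf_den a 0 + 0"
| "cf_den a (Suc (Suc n)) = a (Suc (Suc n)) * cf_den a (Suc n) + cf_den a n"

definition cf_value :: "(nat \<Rightarrow> real) \<Rightarrow> real" where
  "cf_value a = lim (\<lambda>n. cf_num a n / cf_den a n)"

definition cf_digits_of_binary :: "(nat \<Rightarrow> nat) \<Rightarrow> nat \<Rightarrow> real" where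
  "cf_digits_of_binary \<alpha> n = (if odd n then (1/2) ^ (1 - \<alpha> n) else (1/2) ^ \<alpha> n)"

text \<open>
  Binary rationals have two representations, so this is meaningful only because the value does not
  depend on the representation chosen. Outside \<open>{0..1}\<close> the value is unspecified.
\<close>

definition binary_to_cf :: "real \<Rightarrow> real" where
  "binary_to_cf x =
     (THE y. \<exists>\<alpha>. binary_digits \<alpha> \<and> x = binary_value \<alpha> \<and> y = cf_value (cf_digits_of_binary \<alpha>))"

definition singular_on :: "(real \<Rightarrow> real) \<Rightarrow> real set \<Rightarrow> bool" where
  "singular_on f I \<longleftrightarrow>
     continuous_on I f \<and> \<not> f constant_on I \<and>
     (AE x in lebesgue_on I. (f has_real_derivative 0) (at x within I))"

end

theory Submission
  imports Defs
begin

text \<open>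
  The maps \<open>t \<mapsto> 1 / (1/2 + t)\<close> and \<open>t \<mapsto> 1 / (1 + t)\<close> send \<open>[1/2, 1]\<close> onto the adjacent
  intervals \<open>[2/3, 1]\<close> and \<open>[1/2, 2/3]\<close>, and any two of them compose to a contraction. So iteration
  yields a function \<open>f\<close> with \<open>f x = 1 / (1/2 + f (1 - 2 x))\<close> on the left half of \<open>[0, 1]\<close> and
  \<open>f x = 1 / (1 + f (2 - 2 x))\<close> on the right half; it is continuous and decreasing, and the
  contraction makes the convergents of the continued fraction approach its value at the
  corresponding binary number. This also shows that the two representations of a binary rational
  agree.

  On a dyadic interval of rank \<open>n\<close> the function is \<open>(p + p' t) / (q + q' t)\<close> of a rescaled copy of
  itself, with \<open>0 \<le> q' \<le> 2 q\<close>. This bound on the distortion forces the increments over the two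
  halves to differ by a factor of at least \<open>4/3\<close>. By strict concavity of the square root, the sum
  of the square roots of the increments of rank \<open>n\<close> is then at most \<open>c ^ n\<close> with \<open>c < sqrt 2\<close>. Hence the
  dyadic intervals whose increment exceeds \<open>s ^ (2 n)\<close>, where \<open>c / 2 < s < 1 / sqrt 2\<close>, have
  summable total length, even with their neighbours added; by Borel-Cantelli almost every point
  avoids them eventually, and there the difference quotients tend to \<open>0\<close>.
\<close>

section \<open>Contraction and the fixed point\<close>

text \<open>The composite is \<open>(b + t) / (a * (b + t) + 1)\<close>, with derivative
  \<open>1 / (a * (b + t) + 1)^2\<close> and base at least \<open>5/4\<close>. A single step does
  not suffice: \<open>1 / (1/2 + t)\<close> has slope -1 at \<open>t = 1/2\<close>. Allowing all
  nonnegative \<open>u\<close>, \<open>v\<close> lets the lemma apply to convergents outside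
  [1/2, 1].\<close>

lemma cf_two_step_contraction:
  fixes a b u v :: real
  assumes "a \<ge> 1/2" "b \<ge> 1/2" "u \<ge> 0" "v \<ge> 0"
  shows "\<bar>1 / (a + 1 / (b + u)) - 1 / (a + 1 / (b + v))\<bar> \<le> 16/25 * \<bar>u - v\<bar>"
proof -
  have den: "a * (b + t) + 1 \<ge> 5/4" if "t \<ge> 0" for t
    using mult_mono[of "1/2" a "1/2" "b + t"] assms that by simp
  have eq: "1 / (a + 1 / (b + t)) = (b + t) / (a * (b + t) + 1)" if "t \<ge> 0" for t
    using assms that den[OF that] by (simp add: field_simps)
  have "1 / (a + 1 / (b + u)) - 1 / (a + 1 / (b + v))
      = (u - v) / ((a * (b + u) + 1) * (a * (b + v) + 1))"
    unfolding eq[OF assms(3)] eq[OF assms(4)]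
    using den[OF assms(3)] den[OF assms(4)] by (simp add: diff_frac_eq) (simp add: algebra_simps)
  also have "\<bar>\<dots>\<bar> = \<bar>u - v\<bar> / ((a * (b + u) + 1) * (a * (b + v) + 1))"
    using den[OF assms(3)] den[OF assms(4)] by (simp add: abs_mult)
  also have "\<dots> \<le> \<bar>u - v\<bar> / (25/16)"
    using mult_mono[OF den[OF assms(3)] den[OF assms(4)]] den[OF assms(3)]
    by (intro divide_left_mono) auto
  finally show ?thesis by simp
qed

text \<open>Removing a digit flips the parity of all later indices, which amounts to complementing
  the remaining binary digits; this is the reflection in \<open>1 - 2 * x\<close> and
  \<open>2 - 2 * x\<close>.\<close>

definition cf_step :: "(real \<Rightarrow> real) \<Rightarrow> real \<Rightarrow> real" where
  "cf_step \<phi> x = (if x \<le> 1/2 then 1 / (1/2 + \<phi> (1 - 2 * x)) else 1 / (1 + \<phi> (2 - 2 * x)))"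

text \<open>Keeping all functions constant outside the unit interval spares the boundary cases when
  neighbouring dyadic intervals are considered.\<close>

definition descending :: "(real \<Rightarrow> real) \<Rightarrow> bool" where
  "descending \<phi> \<longleftrightarrow> continuous_on UNIV \<phi> \<and> antimono \<phi> \<and> (\<forall>x\<le>0. \<phi> x = 1) \<and> (\<forall>x\<ge>1. \<phi> x = 1/2)"

lemma descending_bounds:
  assumes "descending \<phi>"
  shows "1/2 \<le> \<phi> x" "\<phi> x \<le> 1"
proof -
  have m: "antimono \<phi>" and "\<phi> (min x 0) = 1" "\<phi> (max x 1) = 1/2"
    using assms by (auto simp: descending_def)
  then show "1/2 \<le> \<phi> x" "\<phi> x \<le> 1"
    using antimonoD[OF m, of "min x 0" x] antimonoD[OF m, of x "max x 1"] by auto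
qed

lemma
  assumes "descending \<phi>"
  shows descending_zero: "\<phi> 0 = 1" and descending_one: "\<phi> 1 = 1/2"
  using assms by (auto simp: descending_def)

text \<open>The endpoint values 1 and \<open>1/2\<close> make both branches equal \<open>2/3\<close>
  at \<open>x = 1/2\<close>, which gives continuity; \<open>2/3\<close> also separates the ranges of
  the branches, which gives monotonicity across the midpoint.\<close>

lemma descending_cf_step:
  assumes "descending \<phi>"
  shows "descending (cf_step \<phi>)"
proof -
  have cont: "continuous_on S \<phi>" for S
    using assms continuous_on_subset by (auto simp: descending_def)
  have m: "antimono \<phi>" and lo: "\<And>x. x \<le> 0 \<Longrightarrow> \<phi> x = 1" and hi: "\<And>x. x \<ge> 1 \<Longrightarrow> \<phi> x = 1/2"
    using assms by (auto simp: descending_def)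
  have pos: "\<phi> x > 0" for x
    using descending_bounds(1)[OF assms, of x] by linarith
  have c: "continuous_on S (\<lambda>x. \<phi> (k - 2 * x))" for S and k :: real
    by (intro continuous_on_compose2[OF cont[of UNIV]] continuous_intros) auto
  have "continuous_on ({..1/2} \<union> {1/2..}) (cf_step \<phi>)"
    unfolding cf_step_def
  proof (rule continuous_on_cases)
    show "continuous_on {..1/2} (\<lambda>x. 1 / (1/2 + \<phi> (1 - 2 * x)))"
      "continuous_on {1/2..} (\<lambda>x. 1 / (1 + \<phi> (2 - 2 * x)))"
      using pos by (auto intro!: continuous_intros c simp: add_pos_pos less_imp_neq[THEN not_sym])
  qed (auto simp: lo hi)
  moreover have "{..1/2} \<union> {1/2..} = (UNIV :: real set)" by auto
  ultimately have "continuous_on UNIV (cf_step \<phi>)" by simp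
  moreover have "antimono (cf_step \<phi>)"
  proof (rule antimonoI)
    fix x y :: real assume xy: "x \<le> y"
    have 1: "1 / (c + \<phi> (k - 2 * y)) \<le> 1 / (c + \<phi> (k - 2 * x))" if "c > 0" for c k
      using antimonoD[OF m, of "k - 2 * y" "k - 2 * x"] xy pos that
      by (intro divide_left_mono) (auto simp: add_pos_pos)
    have 2: "1 / (1 + \<phi> (2 - 2 * y)) \<le> 2/3" if "y > 1/2"
    proof -
      have "\<phi> (2 - 2 * y) \<ge> 1/2" using descending_bounds[OF assms] by simp
      then show ?thesis by (simp add: field_simps)
    qed
    have 3: "2/3 \<le> 1 / (1/2 + \<phi> (1 - 2 * x))"
      using descending_bounds(2)[OF assms, of "1 - 2 * x"] pos[of "1 - 2 * x"]
      by (simp add: field_simps)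
    show "cf_step \<phi> y \<le> cf_step \<phi> x"
      using 1[of 1 2] 1[of "1/2" 1] 2 3 xy by (auto simp: cf_step_def)
  qed
  ultimately show ?thesis
    by (auto simp: descending_def cf_step_def lo hi)
qed

text \<open>Digit and new argument depend on \<open>x\<close> alone, so iterates of different
  functions can be compared along the same path.\<close>

lemma cf_step_branch:
  obtains a y where "a \<ge> 1/2" "\<And>\<phi>. cf_step \<phi> x = 1 / (a + \<phi> y)"
proof (cases "x \<le> 1/2")
  case True
  then show ?thesis using that[of "1/2" "1 - 2 * x"] by (simp add: cf_step_def)
next
  case False
  then show ?thesis using that[of 1 "2 - 2 * x"] by (simp add: cf_step_def)
qed

lemma descending_cf_step_funpow: "descending \<phi> \<Longrightarrow> descending ((cf_step ^^ n) \<phi>)"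
  by (induction n) (auto intro: descending_cf_step)

text \<open>Two steps gain \<open>16/25\<close>, the square of \<open>4/5\<close>. Both base cases
  hold because all values lie in [1/2, 1].\<close>

lemma cf_step_funpow_contraction:
  assumes "descending \<phi>" "descending \<psi>"
  shows "\<bar>(cf_step ^^ n) \<phi> x - (cf_step ^^ n) \<psi> x\<bar> \<le> (4/5) ^ n"
proof (induction n arbitrary: x rule: induct_nat_012)
  case 0
  show ?case
    using descending_bounds[OF assms(1), of x] descending_bounds[OF assms(2), of x] by simp
next
  case 1
  have "\<bar>cf_step \<phi> x - cf_step \<psi> x\<bar> \<le> 4/5"
    using descending_bounds[OF descending_cf_step[OF assms(1)], of x]
      descending_bounds[OF descending_cf_step[OF assms(2)], of x] by linarith
  then show ?case by simp
next
  case (ge2 n)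
  obtain a y where a: "a \<ge> 1/2" "\<And>\<phi>. cf_step \<phi> x = 1 / (a + \<phi> y)"
    by (rule cf_step_branch) blast
  obtain b z where b: "b \<ge> 1/2" "\<And>\<phi>. cf_step \<phi> y = 1 / (b + \<phi> z)"
    by (rule cf_step_branch) blast
  have eq: "(cf_step ^^ Suc (Suc n)) \<rho> x = 1 / (a + 1 / (b + (cf_step ^^ n) \<rho> z))" for \<rho>
    by (simp add: a b)
  have "\<bar>(cf_step ^^ Suc (Suc n)) \<phi> x - (cf_step ^^ Suc (Suc n)) \<psi> x\<bar>
      \<le> 16/25 * \<bar>(cf_step ^^ n) \<phi> z - (cf_step ^^ n) \<psi> z\<bar>"
    unfolding eq
    using descending_bounds(1)[OF descending_cf_step_funpow[OF assms(1)], of n z]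
      descending_bounds(1)[OF descending_cf_step_funpow[OF assms(2)], of n z] a b
    by (intro cf_two_step_contraction) auto
  also have "\<dots> \<le> 16/25 * (4/5) ^ n"
    using ge2.IH(1)[of z] by simp
  finally show ?case by simp
qed

lemma cf_step_fixed_point: "\<exists>f. descending f \<and> cf_step f = f"
proof -
  \<comment> \<open>Any descending function would serve as a start; this one is linear between the
    prescribed end values.\<close>
  define \<phi>0 :: "real \<Rightarrow> real" where "\<phi>0 x = max (1/2) (min 1 (1 - x / 2))" for x
  have \<phi>0: "descending \<phi>0"
    unfolding descending_def \<phi>0_def
    by (auto intro!: continuous_intros antimonoI)
  define \<Phi> where "\<Phi> n = (cf_step ^^ n) \<phi>0" for n
  have \<Phi>: "descending (\<Phi> n)" for n
    unfolding \<Phi>_def by (intro descending_cf_step_funpow \<phi>0)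
  \<comment> \<open>\<open>\<Phi> m\<close> is the \<open>n\<close>-fold iterate of
    \<open>\<Phi> (m - n)\<close>, so the contraction compares it with
    \<open>\<Phi> n\<close>.\<close>
  have close: "\<bar>\<Phi> n x - \<Phi> m x\<bar> \<le> (4/5) ^ n" if "n \<le> m" for n m x
    using cf_step_funpow_contraction[OF \<phi>0 \<Phi>[of "m - n"], of n x] that
    by (simp add: \<Phi>_def flip: funpow_add o_apply[of "cf_step ^^ n"])
  have "uniformly_Cauchy_on UNIV \<Phi>"
  proof (rule uniformly_Cauchy_onI')
    fix e :: real assume "e > 0"
    then obtain N where N: "(4/5) ^ N < e"
      using real_arch_pow_inv[of e "4/5"] by auto
    show "\<exists>M. \<forall>x\<in>UNIV. \<forall>m\<ge>M. \<forall>n>m. dist (\<Phi> m x) (\<Phi> n x) < e"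
    proof (intro exI ballI allI impI)
      fix x m n assume "m \<ge> N" "n > m"
      then have "dist (\<Phi> m x) (\<Phi> n x) \<le> (4/5) ^ m"
        using close[of m n x] by (simp add: dist_real_def)
      also have "\<dots> \<le> (4/5) ^ N"
        using \<open>m \<ge> N\<close> by (intro power_decreasing) auto
      finally show "dist (\<Phi> m x) (\<Phi> n x) < e" using N by simp
    qed
  qed
  then obtain f where f: "uniform_limit UNIV \<Phi> f sequentially"
    using Cauchy_uniformly_convergent uniformly_convergent_on_def by blast
  then have lim: "(\<lambda>n. \<Phi> n x) \<longlonglongrightarrow> f x" for x
    by (auto intro: tendsto_uniform_limitI)
  have "continuous_on UNIV f"
    using \<Phi> by (intro uniform_limit_theorem[OF _ f]) (auto simp: descending_def)
  moreover have "antimono f"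
  proof (rule antimonoI)
    fix x y :: real assume "x \<le> y"
    then show "f y \<le> f x"
      using \<Phi> by (intro LIMSEQ_le[OF lim lim]) (auto simp: descending_def antimono_def)
  qed
  moreover have "f x = 1" if "x \<le> 0" for x
    by (rule LIMSEQ_unique[OF lim]) (use \<Phi> that in \<open>auto simp: descending_def\<close>)
  moreover have "f x = 1/2" if "x \<ge> 1" for x
  proof -
    have "\<Phi> n x = 1/2" for n using \<Phi> that by (auto simp: descending_def)
    then have "(\<lambda>n. \<Phi> n x) \<longlonglongrightarrow> 1/2" by (simp only: tendsto_const)
    then show ?thesis by (rule LIMSEQ_unique[OF lim])
  qed
  ultimately have d: "descending f"
    unfolding descending_def by blast
  have "cf_step f x = f x" for x
  proof (rule LIMSEQ_unique)
    obtain a y where a: "a \<ge> 1/2" "\<And>\<phi>. cf_step \<phi> x = 1 / (a + \<phi> y)"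
      by (rule cf_step_branch) blast
    have "(\<lambda>n. 1 / (a + \<Phi> n y)) \<longlonglongrightarrow> 1 / (a + f y)"
      using descending_bounds(1)[OF d, of y] a(1) by (intro tendsto_intros lim) auto
    then show "(\<lambda>n. \<Phi> (Suc n) x) \<longlonglongrightarrow> cf_step f x"
      by (simp add: \<Phi>_def a)
    show "(\<lambda>n. \<Phi> (Suc n) x) \<longlonglongrightarrow> f x"
      by (intro LIMSEQ_Suc lim)
  qed
  with d show ?thesis by blast
qed

section \<open>Digit shifts and the value of the continued fraction\<close>

text \<open>The defining recurrences append a digit at the end, whereas the functional equation
  removes one at the front; these identities translate between the two.\<close>

lemma cf_shift:
  "cf_num a (Suc n) = cf_den (\<lambda>i. a (Suc i)) n"
  "cf_den a (Suc n) = a 1 * cf_den (\<lambda>i. a (Suc i)) n + cf_num (\<lambda>i. a (Suc i)) n"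
  by (induction n rule: induct_nat_012) (auto simp: algebra_simps)

lemma cf_den_pos:
  assumes "\<And>n. a n > 0"
  shows "cf_den a n > 0"
  by (induction n rule: induct_nat_012) (use assms in \<open>auto intro!: add_pos_pos mult_pos_pos\<close>)

lemma cf_num_nonneg:
  assumes "\<And>n. a n > 0"
  shows "cf_num a n \<ge> 0"
  by (induction n rule: induct_nat_012) (use assms in \<open>auto intro!: add_nonneg_nonneg mult_nonneg_nonneg simp: less_imp_le\<close>)

lemma convergent_shift:
  assumes "\<And>n. a n > 0"
  shows "cf_num a (Suc n) / cf_den a (Suc n)
    = 1 / (a 1 + cf_num (\<lambda>i. a (Suc i)) n / cf_den (\<lambda>i. a (Suc i)) n)"
proof -
  have "cf_den (\<lambda>i. a (Suc i)) n > 0" by (intro cf_den_pos assms)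
  then show ?thesis unfolding cf_shift
    by (simp add: add_divide_eq_iff)
qed

text \<open>The digit convention alternates with the parity of the index, so that a shift of the
  continued fraction complements the binary digits.\<close>

definition shift_complement :: "(nat \<Rightarrow> nat) \<Rightarrow> nat \<Rightarrow> nat" where
  "shift_complement \<alpha> n = 1 - \<alpha> (Suc n)"

lemma binary_digits_shift_complement: "binary_digits (shift_complement \<alpha>)"
  by (auto simp: binary_digits_def shift_complement_def)

lemma cf_digits_shift_complement:
  assumes "binary_digits \<alpha>"
  shows "cf_digits_of_binary (shift_complement \<alpha>) n = cf_digits_of_binary \<alpha> (Suc n)"
proof -
  have "\<alpha> (Suc n) \<in> {0, 1}" using assms by (auto simp: binary_digits_def)
  then show ?thesis by (auto simp: cf_digits_of_binary_def shift_complement_def)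
qed

lemma binary_digits_summable:
  assumes "binary_digits \<alpha>"
  shows "summable (\<lambda>n. real (\<alpha> (Suc n)) / 2 ^ Suc n)"
proof (rule summable_comparison_test')
  show "summable (\<lambda>n. (1/2 :: real) ^ Suc n)"
    using summable_geometric[of "1/2 :: real"] by (subst summable_Suc_iff) auto
  show "norm (real (\<alpha> (Suc n)) / 2 ^ Suc n) \<le> (1/2) ^ Suc n" if "n \<ge> 0" for n
  proof -
    have "\<alpha> (Suc n) \<in> {0, 1}" using assms by (auto simp: binary_digits_def)
    then show ?thesis by (auto simp: power_one_over field_simps)
  qed
qed

lemma binary_value_bounds:
  assumes "binary_digits \<alpha>"
  shows "0 \<le> binary_value \<alpha>" "binary_value \<alpha> \<le> 1"
proof -
  have s: "(\<lambda>n. (1/2 :: real) ^ Suc n) sums 1"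
    by (rule power_half_series)
  have le: "real (\<alpha> (Suc n)) / 2 ^ Suc n \<le> (1/2) ^ Suc n" for n
  proof -
    have "\<alpha> (Suc n) \<in> {0, 1}" using assms by (auto simp: binary_digits_def)
    then show ?thesis by (auto simp: power_one_over field_simps)
  qed
  show "0 \<le> binary_value \<alpha>"
    unfolding binary_value_def by (intro suminf_nonneg binary_digits_summable assms) auto
  show "binary_value \<alpha> \<le> 1"
    unfolding binary_value_def
    using suminf_le[OF le binary_digits_summable[OF assms] sums_summable[OF s]] sums_unique[OF s]
    by simp
qed

text \<open>Since the powers of \<open>1/2\<close> sum to 1, complementing the tail replaces its
  value \<open>t\<close> by \<open>1 - t\<close>.\<close>

lemma binary_value_shift_complement:
  assumes "binary_digits \<alpha>"
  shows "binary_value \<alpha> = (real (\<alpha> 1) + (1 - binary_value (shift_complement \<alpha>))) / 2"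
proof -
  let ?\<beta> = "shift_complement \<alpha>"
  have "binary_value \<alpha> = (\<Sum>n. real (\<alpha> (Suc (Suc n))) / 2 ^ Suc (Suc n)) + real (\<alpha> 1) / 2"
    unfolding binary_value_def using suminf_split_head[OF binary_digits_summable[OF assms]] by simp
  also have "(\<lambda>n. real (\<alpha> (Suc (Suc n))) / 2 ^ Suc (Suc n))
      = (\<lambda>n. ((1/2) ^ Suc n - real (?\<beta> (Suc n)) / 2 ^ Suc n) / 2)"
  proof
    fix n
    have "\<alpha> (Suc (Suc n)) \<in> {0, 1}" using assms by (auto simp: binary_digits_def)
    then show "real (\<alpha> (Suc (Suc n))) / 2 ^ Suc (Suc n)
      = ((1/2) ^ Suc n - real (?\<beta> (Suc n)) / 2 ^ Suc n) / 2"
      by (auto simp: shift_complement_def power_one_over)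
  qed
  also have "suminf \<dots> = (1 - binary_value ?\<beta>) / 2"
    unfolding binary_value_def
    by (intro sums_unique[symmetric] sums_divide sums_diff power_half_series summable_sums
        binary_digits_summable binary_digits_shift_complement)
  finally show ?thesis by (simp add: add_divide_distrib)
qed

text \<open>At \<open>y = 0\<close> the second equation concerns the point \<open>1/2\<close>, which
  \<open>cf_step\<close> assigns to the left branch; it survives because both branches give
  \<open>2/3\<close>. Thus either first digit may be used at \<open>1/2\<close>, so that both
  expansions of a binary rational can be treated alike.\<close>

lemma fixed_point_branches:
  assumes "descending f" "cf_step f = f" "0 \<le> y" "y \<le> 1"
  shows "f (y / 2) = 1 / (1/2 + f (1 - y))" "f ((1 + y) / 2) = 1 / (1 + f (1 - y))"
proof -
  show "f (y / 2) = 1 / (1/2 + f (1 - y))"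
    using assms(3,4) fun_cong[OF assms(2), of "y / 2"] by (simp add: cf_step_def)
  show "f ((1 + y) / 2) = 1 / (1 + f (1 - y))"
  proof (cases "y = 0")
    case True
    then show ?thesis
      using fun_cong[OF assms(2), of "1/2"]
      by (simp add: cf_step_def descending_zero[OF assms(1)] descending_one[OF assms(1)])
  next
    case False
    moreover have "2 - 2 * ((1 + y) / 2) = 1 - y" by (simp add: field_simps)
    ultimately show ?thesis
      using assms(3) fun_cong[OF assms(2), of "(1 + y) / 2"] by (simp only: cf_step_def) simp
  qed
qed

lemma fixed_point_binary_value:
  assumes "descending f" "cf_step f = f" "binary_digits \<alpha>"
  shows "f (binary_value \<alpha>)
    = 1 / (cf_digits_of_binary \<alpha> 1 + f (binary_value (shift_complement \<alpha>)))"
proof -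
  let ?y = "1 - binary_value (shift_complement \<alpha>)"
  have y: "0 \<le> ?y" "?y \<le> 1"
    using binary_value_bounds[OF binary_digits_shift_complement] by auto
  have "\<alpha> 1 \<in> {0, 1}" using assms by (auto simp: binary_digits_def)
  then show ?thesis
    using fixed_point_branches[OF assms(1,2) y]
    by (auto simp: binary_value_shift_complement[OF assms(3)] cf_digits_of_binary_def)
qed

lemma cf_digits_ge:
  assumes "binary_digits \<alpha>" "n \<ge> 1"
  shows "cf_digits_of_binary \<alpha> n \<ge> 1/2"
proof -
  have "\<alpha> n \<in> {0, 1}" using assms by (auto simp: binary_digits_def)
  then show ?thesis by (auto simp: cf_digits_of_binary_def)
qed

text \<open>The induction removes two digits at a time. The factor \<open>5/2\<close> makes the
  bound 2 at \<open>n = 1\<close>, where the convergent is the reciprocal of the first digit and may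
  be as large as 2.\<close>

lemma convergents_close_to_fixed_point:
  assumes "descending f" "cf_step f = f" "binary_digits \<alpha>"
  shows "\<bar>cf_num (cf_digits_of_binary \<alpha>) n / cf_den (cf_digits_of_binary \<alpha>) n - f (binary_value \<alpha>)\<bar>
    \<le> 5/2 * (4/5) ^ n"
  using assms(3)
proof (induction n arbitrary: \<alpha> rule: induct_nat_012)
  case 0
  show ?case using descending_bounds[OF assms(1), of "binary_value \<alpha>"] by simp
next
  case 1
  let ?a = "cf_digits_of_binary \<alpha> 1"
  have a: "?a \<ge> 1/2" using cf_digits_ge[OF 1] by simp
  have "1 / ?a \<le> 2" using a by (simp add: field_simps)
  moreover have "0 \<le> 1 / ?a" using a by simp
  ultimately have "\<bar>1 / ?a - f (binary_value \<alpha>)\<bar> \<le> 2"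
    using descending_bounds[OF assms(1), of "binary_value \<alpha>"] by linarith
  then show ?case by simp
next
  case (ge2 n)
  let ?c = cf_digits_of_binary and ?\<beta> = "shift_complement \<alpha>"
  let ?\<gamma> = "shift_complement ?\<beta>"
  have pos: "?c \<delta> n > 0" for \<delta> n by (simp add: cf_digits_of_binary_def)
  have sh: "(\<lambda>i. ?c \<delta> (Suc i)) = ?c (shift_complement \<delta>)" if "binary_digits \<delta>" for \<delta>
    using cf_digits_shift_complement[OF that] by auto
  note dig = ge2.prems binary_digits_shift_complement[of \<alpha>] binary_digits_shift_complement[of ?\<beta>]
  let ?t = "cf_num (?c ?\<gamma>) n / cf_den (?c ?\<gamma>) n"
  have "cf_num (?c \<alpha>) (Suc (Suc n)) / cf_den (?c \<alpha>) (Suc (Suc n)) = 1 / (?c \<alpha> 1 + 1 / (?c ?\<beta> 1 + ?t))"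
    unfolding convergent_shift[of "?c \<alpha>", OF pos] sh[OF dig(1)]
      convergent_shift[of "?c ?\<beta>", OF pos] sh[OF dig(2)] ..
  moreover have "f (binary_value \<alpha>) = 1 / (?c \<alpha> 1 + 1 / (?c ?\<beta> 1 + f (binary_value ?\<gamma>)))"
    by (simp add: fixed_point_binary_value[OF assms(1,2)] dig)
  moreover have "?t \<ge> 0"
    using cf_num_nonneg[of "?c ?\<gamma>", OF pos, of n] cf_den_pos[of "?c ?\<gamma>", OF pos, of n] by simp
  moreover have "f (binary_value ?\<gamma>) \<ge> 0"
    using descending_bounds(1)[OF assms(1), of "binary_value ?\<gamma>"] by linarith
  ultimately have "\<bar>cf_num (?c \<alpha>) (Suc (Suc n)) / cf_den (?c \<alpha>) (Suc (Suc n)) - f (binary_value \<alpha>)\<bar>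
      \<le> 16/25 * \<bar>?t - f (binary_value ?\<gamma>)\<bar>"
    using cf_two_step_contraction[OF cf_digits_ge[OF dig(1)] cf_digits_ge[OF dig(2)]] by auto
  also have "\<dots> \<le> 16/25 * (5/2 * (4/5) ^ n)"
    using ge2.IH(1)[OF dig(3)] by simp
  finally show ?case by simp
qed

lemma cf_value_eq_fixed_point:
  assumes "descending f" "cf_step f = f" "binary_digits \<alpha>"
  shows "cf_value (cf_digits_of_binary \<alpha>) = f (binary_value \<alpha>)"
proof -
  have z: "(\<lambda>n. 5/2 * (4/5 :: real) ^ n) \<longlonglongrightarrow> 0"
    by (intro tendsto_mult_right_zero LIMSEQ_power_zero) auto
  have "(\<lambda>n. cf_num (cf_digits_of_binary \<alpha>) n / cf_den (cf_digits_of_binary \<alpha>) n - f (binary_value \<alpha>)) \<longlonglongrightarrow> 0"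
    by (rule Lim_null_comparison[OF _ z]) (use convergents_close_to_fixed_point[OF assms] in simp)
  then show ?thesis
    unfolding cf_value_def by (intro limI) (simp add: LIM_zero_iff)
qed

section \<open>Existence of binary expansions\<close>

lemma binary_expansion_exists:
  assumes "x \<in> {0..1}"
  shows "\<exists>\<alpha>. binary_digits \<alpha> \<and> binary_value \<alpha> = x"
\<comment> \<open>The floor digits used below would all vanish at \<open>x = 1\<close>, which needs
  the expansion with all digits 1.\<close>
proof (cases "x = 1")
  case True
  have "binary_value (\<lambda>_. 1) = x"
    using sums_unique[OF power_half_series] True by (simp add: binary_value_def power_one_over)
  then show ?thesis by (intro exI[of _ "\<lambda>_. 1"]) (simp add: binary_digits_def)
next
  case False
  with assms have x: "0 \<le> x" "x < 1" by auto
  define \<alpha> where "\<alpha> n = nat (\<lfloor>2 ^ n * x\<rfloor> mod 2)" for n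
  have \<alpha>: "binary_digits \<alpha>"
    unfolding binary_digits_def \<alpha>_def by auto
  have partial: "(\<Sum>i<n. real (\<alpha> (Suc i)) / 2 ^ Suc i) = \<lfloor>2 ^ n * x\<rfloor> / 2 ^ n" for n
  proof (induction n)
    case 0
    then show ?case using x by (simp add: floor_eq_iff)
  next
    case (Suc n)
    let ?m = "\<lfloor>2 ^ Suc n * x\<rfloor>"
    have "?m div 2 = \<lfloor>2 ^ n * x\<rfloor>"
      using floor_divide_real_eq_div[of 2 "2 ^ Suc n * x"] by simp
    then have "?m = 2 * \<lfloor>2 ^ n * x\<rfloor> + ?m mod 2"
      by presburger
    moreover have "real (\<alpha> (Suc n)) = real_of_int (?m mod 2)"
      by (simp add: \<alpha>_def)
    ultimately have "real_of_int ?m = 2 * real_of_int \<lfloor>2 ^ n * x\<rfloor> + real (\<alpha> (Suc n))"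
      by (metis of_int_add of_int_mult of_int_numeral)
    then show ?case using Suc by (simp add: field_simps)
  qed
  have "(\<lambda>n. \<lfloor>2 ^ n * x\<rfloor> / 2 ^ n - x) \<longlonglongrightarrow> 0"
  proof (rule Lim_null_comparison[OF _ LIMSEQ_power_zero])
    show "\<forall>\<^sub>F n in sequentially. norm (\<lfloor>2 ^ n * x\<rfloor> / 2 ^ n - x) \<le> (1/2) ^ n"
    proof (rule always_eventually, rule allI)
      fix n
      have "\<bar>real_of_int \<lfloor>2 ^ n * x\<rfloor> - 2 ^ n * x\<bar> \<le> 1" by linarith
      moreover have "\<lfloor>2 ^ n * x\<rfloor> / 2 ^ n - x = (\<lfloor>2 ^ n * x\<rfloor> - 2 ^ n * x) / 2 ^ n"
        by (simp add: field_simps)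
      ultimately show "norm (\<lfloor>2 ^ n * x\<rfloor> / 2 ^ n - x) \<le> (1/2) ^ n"
        by (simp only: real_norm_def abs_divide) (simp add: power_one_over divide_right_mono)
    qed
  qed auto
  then have "(\<lambda>n. real (\<alpha> (Suc n)) / 2 ^ Suc n) sums x"
    unfolding sums_def partial by (simp add: LIM_zero_iff)
  then show ?thesis using \<alpha> sums_unique by (auto simp: binary_value_def)
qed


section \<open>Distortion on dyadic intervals\<close>

text \<open>A further digit \<open>c\<close> turns the denominator pair \<open>(q, q')\<close> into
  \<open>(q * c + q', q)\<close>, and \<open>c \<ge> 1/2\<close> preserves the bound
  \<open>q' \<le> 2 * q\<close>. Each bisection reverses the orientation, hence the two
  alternatives.\<close>

lemma fixed_point_moebius:
  assumes "descending f" "cf_step f = f" and "j < 2 ^ n"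
  shows "\<exists>p p' q q'. q > 0 \<and> 0 \<le> q' \<and> q' \<le> 2 * q \<and>
    ((\<forall>y\<in>{0..1}. f ((real j + y) / 2 ^ n) = (p + p' * f y) / (q + q' * f y)) \<or>
     (\<forall>y\<in>{0..1}. f ((real j + y) / 2 ^ n) = (p + p' * f (1 - y)) / (q + q' * f (1 - y))))"
  using assms(3)
proof (induction n arbitrary: j)
  case 0
  show ?case
    by (rule exI[of _ 0], rule exI[of _ 1], rule exI[of _ 1], rule exI[of _ 0]) (use 0 in auto)
next
  case (Suc n)
  define i b where "i = j div 2" and "b = j mod 2"
  have j: "j = 2 * i + b" and b: "b = 0 \<or> b = 1"
    by (auto simp: i_def b_def)
  have "i < 2 ^ n" using Suc.prems by (simp add: i_def)
  from Suc.IH[OF this] obtain p p' q q' where q: "q > 0" "0 \<le> q'" "q' \<le> 2 * q" and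
    f: "(\<forall>y\<in>{0..1}. f ((real i + y) / 2 ^ n) = (p + p' * f y) / (q + q' * f y)) \<or>
        (\<forall>y\<in>{0..1}. f ((real i + y) / 2 ^ n) = (p + p' * f (1 - y)) / (q + q' * f (1 - y)))"
    by blast
  have compose: "(p + p' * (1 / (c + t))) / (q + q' * (1 / (c + t)))
      = ((p * c + p') + p * t) / ((q * c + q') + q * t)" if "c > 0" "t > 0" for c t :: real
  proof -
    have "p + p' * (1 / (c + t)) = (p * c + p' + p * t) / (c + t)"
      "q + q' * (1 / (c + t)) = (q * c + q' + q * t) / (c + t)"
      using that by (simp_all add: field_simps)
    then show ?thesis using that by simp
  qed
  have pos: "f x > 0" for x using descending_bounds(1)[OF assms(1), of x] by linarith
  \<comment> \<open>\<open>c0\<close> is the digit of the chosen half; \<open>c1\<close> is that of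
    the mirrored half, relevant when the inherited formula is reflected.\<close>
  define c0 c1 :: real where "c0 = (if b = 0 then 1/2 else 1)" and "c1 = (if b = 0 then 1 else 1/2)"
  have c: "c0 \<ge> 1/2" "c1 \<ge> 1/2" by (auto simp: c0_def c1_def)
  have arg: "(real j + y) / 2 ^ Suc n = (real i + (real b + y) / 2) / 2 ^ n" for y
    by (simp add: j field_simps)
  have arg01: "(real b + y) / 2 \<in> {0..1}" if "y \<in> {0..1}" for y
    using b that by auto
  have f0: "f ((real b + y) / 2) = 1 / (c0 + f (1 - y))" if "y \<in> {0..1}" for y
    using fixed_point_branches[OF assms(1,2), of y] b that by (auto simp: c0_def)
  have f1: "f (1 - (real b + y) / 2) = 1 / (c1 + f y)" if "y \<in> {0..1}" for y
  proof -
    have "1 - (real b + y) / 2 = (if b = 0 then (1 + (1 - y)) / 2 else (1 - y) / 2)"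
      using b by (auto simp: field_simps)
    then show ?thesis
      using fixed_point_branches[OF assms(1,2), of "1 - y"] b that by (auto simp: c1_def)
  qed
  have q_new: "q * c + q' > 0" "0 \<le> q" "q \<le> 2 * (q * c + q')" if "c \<ge> 1/2" for c
  proof -
    have "q * (1/2) \<le> q * c" using q that by (intro mult_left_mono) auto
    then have "q \<le> 2 * (q * c)" by (simp only: times_divide_eq_right mult_1_right divide_le_eq_numeral1 mult.commute)
    with q show "q * c + q' > 0" "0 \<le> q" "q \<le> 2 * (q * c + q')"
      unfolding distrib_left by linarith+
  qed
  from f show ?case
  proof
    assume f: "\<forall>y\<in>{0..1}. f ((real i + y) / 2 ^ n) = (p + p' * f y) / (q + q' * f y)"
    have "f ((real j + y) / 2 ^ Suc n)
        = ((p * c0 + p') + p * f (1 - y)) / ((q * c0 + q') + q * f (1 - y))"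
      if "y \<in> {0..1}" for y
      unfolding arg f[rule_format, OF arg01[OF that]] f0[OF that] using c pos
      by (intro compose) auto
    then show ?thesis using q_new[OF c(1)] by blast
  next
    assume f: "\<forall>y\<in>{0..1}. f ((real i + y) / 2 ^ n) = (p + p' * f (1 - y)) / (q + q' * f (1 - y))"
    have "f ((real j + y) / 2 ^ Suc n) = ((p * c1 + p') + p * f y) / ((q * c1 + q') + q * f y)"
      if "y \<in> {0..1}" for y
      unfolding arg f[rule_format, OF arg01[OF that]] f1[OF that] using c pos
      by (intro compose) auto
    then show ?thesis using q_new[OF c(2)] by blast
  qed
qed

text \<open>The points 1, \<open>2/3\<close>, \<open>1/2\<close> are the values of the fixed point
  at 0, \<open>1/2\<close>, 1. The ratio of the two increments is
  \<open>(2 * q + q') / (q + q')\<close>, which is at least \<open>4/3\<close> exactly when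
  \<open>q' \<le> 2 * q\<close>.\<close>

lemma moebius_uneven:
  fixes p p' q q' :: real
  assumes "q > 0" "0 \<le> q'" "q' \<le> 2 * q"
  defines "M \<equiv> \<lambda>t. (p + p' * t) / (q + q' * t)"
  shows "4 * \<bar>M (2/3) - M (1/2)\<bar> \<le> 3 * \<bar>M 1 - M (2/3)\<bar>"
proof -
  have diff: "M s - M t = (s - t) * (p' * q - p * q') / ((q + q' * s) * (q + q' * t))"
    if "s \<ge> 0" "t \<ge> 0" for s t
  proof -
    have "q + q' * s > 0" "q + q' * t > 0" using assms that by (auto intro!: add_pos_nonneg)
    then show ?thesis unfolding M_def by (simp add: diff_frac_eq) (simp add: algebra_simps)
  qed
  define d where "d = \<bar>p' * q - p * q'\<bar> / (q + q' * (2/3))"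
  have pos: "q + q' * (2/3) > 0" "q + q' > 0" "q + q' * (1/2) > 0" using assms by auto
  have "\<bar>M (2/3) - M (1/2)\<bar> = d * (1/6 / (q + q' * (1/2)))"
    "\<bar>M 1 - M (2/3)\<bar> = d * (1/3 / (q + q'))"
    using pos by (simp_all add: diff d_def abs_mult)
  moreover have "d * (4 * (1/6 / (q + q' * (1/2)))) \<le> d * (3 * (1/3 / (q + q')))"
    using pos assms by (intro mult_left_mono) (simp_all add: d_def field_simps)
  ultimately show ?thesis by (simp only: mult.left_commute)
qed

text \<open>Which half carries the larger increment depends on the orientation of the rescaled copy:
  the left one if it is unreflected, the right one otherwise.\<close>

lemma fixed_point_uneven:
  assumes "descending f" "cf_step f = f" "j < 2 ^ n"
  defines "X \<equiv> f (real j / 2 ^ n) - f ((real j + 1/2) / 2 ^ n)"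
    and "Y \<equiv> f ((real j + 1/2) / 2 ^ n) - f ((real j + 1) / 2 ^ n)"
  shows "4 * X \<le> 3 * Y \<or> 4 * Y \<le> 3 * X"
proof -
  have m: "antimono f" using assms by (simp add: descending_def)
  have XY: "X \<ge> 0" "Y \<ge> 0"
    unfolding X_def Y_def by (simp_all add: antimonoD[OF m] divide_right_mono)
  have f0: "f 0 = 1" and f1: "f 1 = 1/2" and half: "f (1/2) = 2/3"
    using descending_zero[OF assms(1)] descending_one[OF assms(1)]
      fixed_point_branches(1)[OF assms(1,2), of 1] by auto
  from fixed_point_moebius[OF assms(1-3)] obtain p p' q q' where
    q: "q > 0" "0 \<le> q'" "q' \<le> 2 * q" and
    f: "(\<forall>y\<in>{0..1}. f ((real j + y) / 2 ^ n) = (p + p' * f y) / (q + q' * f y)) \<or>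
        (\<forall>y\<in>{0..1}. f ((real j + y) / 2 ^ n) = (p + p' * f (1 - y)) / (q + q' * f (1 - y)))"
    by blast
  define M where "M t = (p + p' * t) / (q + q' * t)" for t
  have M: "4 * \<bar>M (2/3) - M (1/2)\<bar> \<le> 3 * \<bar>M 1 - M (2/3)\<bar>"
    unfolding M_def by (rule moebius_uneven[OF q])
  from f show ?thesis
  proof
    assume "\<forall>y\<in>{0..1}. f ((real j + y) / 2 ^ n) = (p + p' * f y) / (q + q' * f y)"
    from this[rule_format, of 0] this[rule_format, of "1/2"] this[rule_format, of 1]
    have "X = M 1 - M (2/3)" "Y = M (2/3) - M (1/2)"
      unfolding X_def Y_def M_def f0 f1 half by simp_all
    with M XY show ?thesis by simp
  next
    assume "\<forall>y\<in>{0..1}. f ((real j + y) / 2 ^ n) = (p + p' * f (1 - y)) / (q + q' * f (1 - y))"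
    from this[rule_format, of 0] this[rule_format, of "1/2"] this[rule_format, of 1]
    have "X = M (1/2) - M (2/3)" "Y = M (2/3) - M 1"
      unfolding X_def Y_def M_def f0 f1 half by (simp_all add: f0 f1 half)
    with M XY show ?thesis by simp
  qed
qed

section \<open>Square-root sums and the derivative almost everywhere\<close>

text \<open>Unevenness gives \<open>\<bar>X - Y\<bar> \<ge> (X + Y) / 7\<close>, which keeps the
  geometric mean strictly below half the sum. The constant \<open>1411/1000\<close> is below the
  square root of 2.\<close>

lemma sqrt_sum_uneven:
  fixes X Y :: real
  assumes "X \<ge> 0" "Y \<ge> 0" "4 * X \<le> 3 * Y \<or> 4 * Y \<le> 3 * X"
  shows "sqrt X + sqrt Y \<le> 1411/1000 * sqrt (X + Y)"
proof (rule power2_le_imp_le)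
  have "((X + Y) / 7)\<^sup>2 \<le> \<bar>X - Y\<bar>\<^sup>2"
    using assms by (intro power_mono) auto
  moreover have "4 * (X * Y) = (X + Y)\<^sup>2 - \<bar>X - Y\<bar>\<^sup>2"
    by (simp add: power2_eq_square algebra_simps)
  ultimately have "4 * (X * Y) \<le> 48/49 * (X + Y)\<^sup>2"
    by (simp add: power_divide)
  moreover have "0 \<le> (X + Y)\<^sup>2" by simp
  ultimately have "X * Y \<le> 9801/40000 * (X + Y)\<^sup>2"
    by linarith
  then have "X * Y \<le> (99/200)\<^sup>2 * (X + Y)\<^sup>2"
    by (simp add: power_divide)
  then have "X * Y \<le> (99/200 * (X + Y))\<^sup>2"
    by (simp only: power_mult_distrib)
  then have "sqrt (X * Y) \<le> 99/200 * (X + Y)"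
    using assms by (intro real_le_lsqrt) auto
  moreover have "(sqrt X + sqrt Y)\<^sup>2 = X + Y + 2 * sqrt (X * Y)"
    using assms by (simp add: power2_sum real_sqrt_mult)
  ultimately show "(sqrt X + sqrt Y)\<^sup>2 \<le> (1411/1000 * sqrt (X + Y))\<^sup>2"
    using assms by (simp add: power_mult_distrib power_divide)
  show "0 \<le> 1411/1000 * sqrt (X + Y)" using assms by simp
qed

text \<open>An increment \<open>h\<close> is placed between consecutive powers of
  \<open>1/2\<close>; replacing the larger power by the smaller costs only a factor 2.\<close>

lemma has_derivative_zero_from_scales:
  fixes f :: "real \<Rightarrow> real"
  assumes "0 \<le> K" "0 \<le> \<rho>" "\<rho> < 1"
    and scale: "\<And>n y. n \<ge> N \<Longrightarrow> \<bar>y - x\<bar> \<le> 1 / 2 ^ n \<Longrightarrow> \<bar>f y - f x\<bar> \<le> K * \<rho> ^ n / 2 ^ n"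
  shows "(f has_real_derivative 0) (at x)"
  unfolding has_field_derivative_iff
proof (rule LIM_I)
  fix e :: real assume e: "e > 0"
  have "(\<lambda>n. 2 * K * \<rho> ^ n) \<longlonglongrightarrow> 0"
    using assms by (intro tendsto_mult_right_zero LIMSEQ_power_zero) auto
  then have "\<forall>\<^sub>F n in sequentially. 2 * K * \<rho> ^ n < e"
    using e by (rule order_tendstoD)
  then obtain n0 where n0: "\<And>n. n \<ge> n0 \<Longrightarrow> 2 * K * \<rho> ^ n < e"
    by (auto simp: eventually_sequentially)
  define n1 where "n1 = max n0 N"
  show "\<exists>d>0. \<forall>y. y \<noteq> x \<and> norm (y - x) < d \<longrightarrow> norm ((f y - f x) / (y - x) - 0) < e"
  proof (intro exI[of _ "1 / 2 ^ n1"] conjI allI impI)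
    fix y assume y: "y \<noteq> x \<and> norm (y - x) < 1 / 2 ^ n1"
    define h where "h = \<bar>y - x\<bar>"
    have h: "h > 0" "h < 1 / 2 ^ n1" using y by (auto simp: h_def)
    obtain k where k: "(1/2) ^ k < h" using real_arch_pow_inv[of h "1/2"] h by auto
    define m where "m = (LEAST m. (1/2) ^ m < h)"
    have m: "(1/2) ^ m < h" unfolding m_def using k by (rule LeastI)
    have "m > n1"
    proof (rule ccontr)
      assume "\<not> m > n1"
      then have "(1/2 :: real) ^ n1 \<le> (1/2) ^ m" by (intro power_decreasing) auto
      with m h show False by (simp add: power_one_over)
    qed
    then obtain n where n: "m = Suc n" "n \<ge> n1" by (cases m) auto
    have "\<not> (1/2) ^ n < h" using not_less_Least[of n "\<lambda>m. (1/2) ^ m < h"] n by (simp add: m_def)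
    then have "\<bar>f y - f x\<bar> \<le> K * \<rho> ^ n / 2 ^ n"
      using n by (intro scale) (auto simp: n1_def h_def power_one_over)
    also have "\<dots> = 2 * K * \<rho> ^ n * (1/2) ^ m"
      by (simp add: n power_one_over)
    also have "\<dots> < e * h"
      using m n n0[of n] h e assms(1,2)
      by (intro mult_strict_mono') (auto simp: n1_def)
    finally show "norm ((f y - f x) / (y - x) - 0) < e"
      using h by (simp add: h_def divide_less_eq)
  qed auto
qed

lemma sum_sqrt_increments:
  fixes f :: "real \<Rightarrow> real"
  assumes "antimono f" "f 0 - f 1 \<le> 1"
    and uneven: "\<And>n j. j < 2 ^ n \<Longrightarrow>
      4 * (f (real j / 2 ^ n) - f ((real j + 1/2) / 2 ^ n))
        \<le> 3 * (f ((real j + 1/2) / 2 ^ n) - f ((real j + 1) / 2 ^ n)) \<or>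
      4 * (f ((real j + 1/2) / 2 ^ n) - f ((real j + 1) / 2 ^ n))
        \<le> 3 * (f (real j / 2 ^ n) - f ((real j + 1/2) / 2 ^ n))"
  shows "(\<Sum>j<2 ^ n. sqrt (f (real j / 2 ^ n) - f ((real j + 1) / 2 ^ n))) \<le> (1411/1000) ^ n"
proof (induction n)
  case 0
  show ?case using assms(2) by simp
next
  case (Suc n)
  define D where "D n j = f (real j / 2 ^ n) - f ((real j + 1) / 2 ^ n)" for n j
  have D0: "D n j \<ge> 0" for n j
    unfolding D_def by (simp add: antimonoD[OF assms(1)] divide_right_mono)
  have L: "D (Suc n) (2 * j) = f (real j / 2 ^ n) - f ((real j + 1/2) / 2 ^ n)"
    and R: "D (Suc n) (2 * j + 1) = f ((real j + 1/2) / 2 ^ n) - f ((real j + 1) / 2 ^ n)" for j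
  proof -
    have "real (2 * j) / 2 ^ Suc n = real j / 2 ^ n"
      "(real (2 * j) + 1) / 2 ^ Suc n = (real j + 1/2) / 2 ^ n"
      "real (2 * j + 1) / 2 ^ Suc n = (real j + 1/2) / 2 ^ n"
      "(real (2 * j + 1) + 1) / 2 ^ Suc n = (real j + 1) / 2 ^ n"
      by (simp_all add: field_simps)
    then show "D (Suc n) (2 * j) = f (real j / 2 ^ n) - f ((real j + 1/2) / 2 ^ n)"
      "D (Suc n) (2 * j + 1) = f ((real j + 1/2) / 2 ^ n) - f ((real j + 1) / 2 ^ n)"
      unfolding D_def by (simp_all only:)
  qed
  have split: "D (Suc n) (2 * j) + D (Suc n) (2 * j + 1) = D n j" for j
    unfolding L R by (simp add: D_def)
  have "(\<Sum>j<2 ^ Suc n. sqrt (D (Suc n) j))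
      = (\<Sum>j<2 ^ n. sqrt (D (Suc n) (2 * j)) + sqrt (D (Suc n) (2 * j + 1)))"
    \<comment> \<open>Grouping indices in pairs collects the two halves of each interval of rank
      \<open>n\<close>.\<close>
    using sum.nat_group[of "\<lambda>j. sqrt (D (Suc n) j)" 2 "2 ^ n"]
    by (simp add: mult.commute numeral_2_eq_2)
  also have "\<dots> \<le> (\<Sum>j<2 ^ n. 1411/1000 * sqrt (D n j))"
    unfolding split[symmetric]
    using uneven by (intro sum_mono sqrt_sum_uneven D0) (simp_all only: L R lessThan_iff)
  also have "\<dots> = 1411/1000 * (\<Sum>j<2 ^ n. sqrt (D n j))"
    by (simp add: sum_distrib_left)
  also have "\<dots> \<le> 1411/1000 * (1411/1000) ^ n"
    using Suc by (intro mult_left_mono) (auto simp: D_def)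
  finally show ?case by (simp add: D_def)
qed

lemma AE_derivative_zero_if_uneven:
  fixes f :: "real \<Rightarrow> real"
  assumes m: "antimono f" and total: "f 0 - f 1 \<le> 1"
    and left: "\<And>x. x \<le> 0 \<Longrightarrow> f x = f 0" and right: "\<And>x. x \<ge> 1 \<Longrightarrow> f x = f 1"
    and uneven: "\<And>n j. j < 2 ^ n \<Longrightarrow>
      4 * (f (real j / 2 ^ n) - f ((real j + 1/2) / 2 ^ n))
        \<le> 3 * (f ((real j + 1/2) / 2 ^ n) - f ((real j + 1) / 2 ^ n)) \<or>
      4 * (f ((real j + 1/2) / 2 ^ n) - f ((real j + 1) / 2 ^ n))
        \<le> 3 * (f (real j / 2 ^ n) - f ((real j + 1/2) / 2 ^ n))"
  shows "AE x in lborel. (f has_real_derivative 0) (at x)"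
proof -
  \<comment> \<open>The two requirements are \<open>2 * s > 1411/1000\<close> (summability) and \<open>2 * s\<^sup>2 < 1\<close> (decay).\<close>
  define s :: real where "s = 706/1000"
  have s: "s > 0" by (simp add: s_def)
  define D where "D n j = f (real j / 2 ^ n) - f ((real j + 1) / 2 ^ n)" for n j
  define J where "J n = {j. j < 2 ^ n \<and> s ^ n \<le> sqrt (D n j)}" for n
  \<comment> \<open>Both neighbours are included so that points \<open>y\<close> within
    \<open>1 / 2 ^ n\<close> of \<open>x\<close> are controlled even when \<open>x\<close> is near
    an end of its dyadic interval.\<close>
  define B where "B n = (\<Union>j\<in>J n. {(real j - 1) / 2 ^ n .. (real j + 2) / 2 ^ n})" for n
  have D0: "D n j \<ge> 0" for n j
    unfolding D_def by (simp add: antimonoD[OF m] divide_right_mono)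
  have fin: "finite (J n)" for n unfolding J_def by simp
  \<comment> \<open>Markov's inequality: each interval counted in \<open>J n\<close> contributes at
    least \<open>s ^ n\<close> to the sum of square roots.\<close>
  have card: "real (card (J n)) * s ^ n \<le> (1411/1000) ^ n" for n
  proof -
    have "real (card (J n)) * s ^ n = (\<Sum>j\<in>J n. s ^ n)" by simp
    also have "\<dots> \<le> (\<Sum>j\<in>J n. sqrt (D n j))"
      by (intro sum_mono) (simp add: J_def)
    also have "\<dots> \<le> (\<Sum>j<2 ^ n. sqrt (D n j))"
      using D0 by (intro sum_mono2) (auto simp: J_def)
    also have "\<dots> \<le> (1411/1000) ^ n"
      unfolding D_def by (rule sum_sqrt_increments[OF m total uneven])
    finally show ?thesis .
  qed
  have measure_B: "measure lborel (B n) \<le> 3 * (1411/1412) ^ n" for n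
  proof -
    have "measure lborel (B n)
        \<le> (\<Sum>j\<in>J n. measure lborel {(real j - 1) / 2 ^ n .. (real j + 2) / 2 ^ n})"
      unfolding B_def by (intro measure_UNION_le fin) auto
    also have "\<dots> = (\<Sum>j\<in>J n. 3 / 2 ^ n)"
    proof (intro sum.cong refl)
      fix j
      have "(real j - 1) / 2 ^ n \<le> (real j + 2) / 2 ^ n" by (intro divide_right_mono) auto
      then show "measure lborel {(real j - 1) / 2 ^ n .. (real j + 2) / 2 ^ n} = 3 / 2 ^ n"
        by (simp flip: diff_divide_distrib)
    qed
    also have "\<dots> = 3 * (real (card (J n)) * s ^ n) / (2 * s) ^ n"
      using s by (simp add: power_mult_distrib)
    also have "\<dots> \<le> 3 * (1411/1000) ^ n / (2 * s) ^ n"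
      using card[of n] s by (intro divide_right_mono mult_left_mono) auto
    also have "\<dots> = 3 * (1411/1412) ^ n"
    proof -
      have "(1411/1412 :: real) = (1411/1000) / (2 * s)" by (simp add: s_def)
      then show ?thesis by (simp only: power_divide times_divide_eq_right)
    qed
    finally show ?thesis .
  qed
  have "AE x in lborel. \<forall>\<^sub>F n in sequentially. x \<in> space lborel - B n"
  proof (rule borel_cantelli_AE1)
    show meas: "B n \<in> sets lborel" for n
      unfolding B_def using fin by (intro sets.finite_UN) auto
    show "emeasure lborel (B n) < \<infinity>" for n
    proof -
      have "bounded (B n)"
        unfolding B_def using fin by (intro bounded_UN) auto
      then show ?thesis using emeasure_bounded_finite by simp
    qed
    show "summable (\<lambda>n. measure lborel (B n))"
    proof (rule summable_comparison_test')
      show "summable (\<lambda>n. 3 * (1411/1412 :: real) ^ n)"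
        by (intro summable_mult summable_geometric) auto
    qed (use measure_B in auto)
  qed
  then show ?thesis
  proof eventually_elim
    case (elim x)
    then obtain N where N: "\<And>n. n \<ge> N \<Longrightarrow> x \<notin> B n"
      by (auto simp: eventually_sequentially)
    show ?case
    \<comment> \<open>Three adjacent increments of at most \<open>(s\<^sup>2) ^ n\<close> each give
      the constant 3; measured against the length \<open>1 / 2 ^ n\<close> the ratio becomes
      \<open>2 * s\<^sup>2\<close>.\<close>
    proof (rule has_derivative_zero_from_scales[of 3 "2 * s\<^sup>2" N])
      fix n y assume n: "n \<ge> N" and y: "\<bar>y - x\<bar> \<le> 1 / 2 ^ n"
      define k where "k = \<lfloor>2 ^ n * x\<rfloor>"
      have k: "real_of_int k \<le> 2 ^ n * x" "2 ^ n * x < real_of_int k + 1"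
        by (auto simp: k_def)
      have step: "f (real_of_int i / 2 ^ n) - f ((real_of_int i + 1) / 2 ^ n) \<le> (s\<^sup>2) ^ n"
        if i: "k - 1 \<le> i" "i \<le> k + 1" for i
      proof -
        \<comment> \<open>Intervals outside [0, 1] have increment 0 since \<open>f\<close> is
          constant there; for the others \<open>x\<close> lies in the enlarged interval, so avoiding
          \<open>B n\<close> bounds the increment.\<close>
        consider "i < 0" | "i \<ge> 2 ^ n" | "0 \<le> i" "i < 2 ^ n" by linarith
        then show ?thesis
        proof cases
          case 1
          then have "real_of_int i \<le> 0" "real_of_int i + 1 \<le> 0" by linarith+
          then have "f (real_of_int i / 2 ^ n) = f 0" "f ((real_of_int i + 1) / 2 ^ n) = f 0"
            by (auto intro!: left simp: divide_le_0_iff)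
          then show ?thesis by simp
        next
          case 2
          then have ge: "real_of_int i \<ge> 2 ^ n"
            by (metis of_int_le_iff of_int_numeral of_int_power)
          then have "real_of_int i + 1 \<ge> 2 ^ n" by linarith
          with ge have "real_of_int i / 2 ^ n \<ge> 1" "(real_of_int i + 1) / 2 ^ n \<ge> 1"
            by (simp_all only: le_divide_eq_1_pos zero_less_power zero_less_numeral)
          then have "f (real_of_int i / 2 ^ n) = f 1" "f ((real_of_int i + 1) / 2 ^ n) = f 1"
            by (blast intro: right)+
          then show ?thesis by simp
        next
          case 3
          define j where "j = nat i"
          have j: "real j = real_of_int i" "j < 2 ^ n"
            using 3 by (auto simp: j_def nat_less_iff)
          have "real j - 1 \<le> 2 ^ n * x" "2 ^ n * x \<le> real j + 2"
            using i k unfolding j by linarith+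
          then have "x \<in> {(real j - 1) / 2 ^ n .. (real j + 2) / 2 ^ n}"
            by (simp add: field_simps)
          with N[OF n] j(2) have "\<not> s ^ n \<le> sqrt (D n j)"
            unfolding B_def J_def by blast
          then have "(sqrt (D n j))\<^sup>2 \<le> (s ^ n)\<^sup>2"
            using D0 by (intro power_mono) auto
          then have "D n j \<le> (s\<^sup>2) ^ n"
            using D0[of n j] by (simp flip: power_mult add: mult.commute)
          then show ?thesis by (simp add: D_def j)
        qed
      qed
      define u v where "u = (real_of_int k - 1) / 2 ^ n" and "v = (real_of_int k + 2) / 2 ^ n"
      have "f u - f v \<le> 3 * (s\<^sup>2) ^ n"
        using step[of "k - 1"] step[of k] step[of "k + 1"] by (simp add: u_def v_def add.commute)
      moreover have "u \<le> x" "x \<le> v" "u \<le> y" "y \<le> v"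
      proof -
        have "\<bar>2 ^ n * (y - x)\<bar> \<le> 1"
          using y by (simp add: abs_mult pos_le_divide_eq mult.commute)
        then have "\<bar>2 ^ n * y - 2 ^ n * x\<bar> \<le> 1"
          by (simp only: right_diff_distrib)
        then show "u \<le> x" "x \<le> v" "u \<le> y" "y \<le> v"
          using k by (simp_all add: u_def v_def divide_le_eq le_divide_eq mult.commute)
      qed
      ultimately have "\<bar>f y - f x\<bar> \<le> 3 * (s\<^sup>2) ^ n"
        using antimonoD[OF m, of u x] antimonoD[OF m, of u y]
          antimonoD[OF m, of x v] antimonoD[OF m, of y v] by linarith
      then show "\<bar>f y - f x\<bar> \<le> 3 * (2 * s\<^sup>2) ^ n / 2 ^ n"
        by (simp add: power_mult_distrib)
    qed (auto simp: s_def power2_eq_square)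
  qed
qed

section \<open>Transfer to the function defined by digits\<close>

theorem theorem4:
  shows "(\<forall>\<alpha>. binary_digits \<alpha> \<longrightarrow>
            binary_to_cf (binary_value \<alpha>) = cf_value (cf_digits_of_binary \<alpha>)) \<and>
         binary_to_cf \<in> {0..1} \<rightarrow> {1/2..1} \<and>
         singular_on binary_to_cf {0..1}"
proof -
  obtain f where f: "descending f" "cf_step f = f"
    using cf_step_fixed_point by blast
  \<comment> \<open>Every expansion of \<open>x\<close> yields the value \<open>f x\<close>, so the
    definite description has a unique witness.\<close>
  have eq: "binary_to_cf x = f x" if "x \<in> {0..1}" for x
    unfolding binary_to_cf_def
    using binary_expansion_exists[OF that] cf_value_eq_fixed_point[OF f]
    by (intro the_equality) auto
  have cf_value: "binary_to_cf (binary_value \<alpha>) = cf_value (cf_digits_of_binary \<alpha>)"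
    if "binary_digits \<alpha>" for \<alpha>
    using eq[of "binary_value \<alpha>"] binary_value_bounds[OF that] cf_value_eq_fixed_point[OF f that]
    by simp
  have "AE x in lborel. (f has_real_derivative 0) (at x)"
  proof (rule AE_derivative_zero_if_uneven)
    show "antimono f" using f(1) by (simp add: descending_def)
    show "f 0 - f 1 \<le> 1" using descending_zero[OF f(1)] descending_one[OF f(1)] by simp
    show "f x = f 0" if "x \<le> 0" for x
      using f(1) that by (simp add: descending_def)
    show "f x = f 1" if "x \<ge> 1" for x
      using f(1) that unfolding descending_def by (metis order.refl)
  qed (rule fixed_point_uneven[OF f])
  then have "AE x in lebesgue. (f has_real_derivative 0) (at x)"
    by (rule AE_completion)
  then have "AE x in lebesgue. x \<in> {0..1} \<longrightarrow>
      (binary_to_cf has_real_derivative 0) (at x within {0..1})"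
  proof eventually_elim
    case (elim x)
    then show ?case
      \<comment> \<open>The radius 1 is arbitrary: the two functions agree on all of
        \<open>{0..1}\<close>.\<close>
      using eq by (auto intro: has_field_derivative_transform_within[OF has_field_derivative_at_within zero_less_one])
  qed
  then have "AE x in lebesgue_on {0..1}. (binary_to_cf has_real_derivative 0) (at x within {0..1})"
    by (subst AE_restrict_space_iff) auto
  moreover have "continuous_on {0..1} binary_to_cf"
  proof -
    have "continuous_on {0..1} f"
      using f(1) continuous_on_subset by (auto simp: descending_def)
    then show ?thesis by (rule continuous_on_eq) (simp add: eq)
  qed
  moreover have "\<not> binary_to_cf constant_on {0..1}"
  proof
    assume "binary_to_cf constant_on {0..1}"
    then have "binary_to_cf 0 = binary_to_cf 1" by (auto simp: constant_on_def)
    then show False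
      using eq[of 0] eq[of 1] descending_zero[OF f(1)] descending_one[OF f(1)] by simp
  qed
  moreover have "binary_to_cf \<in> {0..1} \<rightarrow> {1/2..1}"
    using eq descending_bounds[OF f(1)] by auto
  ultimately show ?thesis using cf_value by (simp add: singular_on_def)
qed

end
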